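(* Let $Z\colon \Theta \to (0,\infty)$ and $\widetilde{Z} \colon \Theta \to (0,\infty)$ be measurable functions with $C_Z, C_{\widetilde Z}\in(0,\infty)$, and let $\pi_Z$ and $\pi_{\widetilde Z}$ be the associated probability measures on $\Theta$. Then $$ \Vert \pi_Z - \pi_{\widetilde{Z}} \Vert_{\rm tv} \leq 2 \left \Vert \frac{ Z}{ \widetilde Z} -1 \right \Vert_{\pi_{ Z},1}. $$
   Context: $(\Theta,d)$ is a complete separable metric space with Borel $\sigma$-algebra $\mathcal{B}(\Theta)$ and a $\sigma$-finite reference measure $\mu$; $\Phi\colon\Theta\to(-\infty,\infty)$ is a fixed measurable function. For measurable $Z\colon\Theta\to(0,\infty)$ set $C_Z := \int_\Theta \frac{\exp(-\Phi(\theta))}{Z(\theta)}\,\mu(\mathrm{d}\theta)$, and if $C_Z\in(0,\infty)$ define the probability measure $\pi_Z(A) := \frac{1}{C_Z}\int_A \frac{\exp(-\Phi(\theta))}{Z(\theta)}\,\mu(\mathrm{d}\theta)$ for $A\in\mathcal{B}(\Theta)$; similarly $C_{\widetilde Z}$ and $\pi_{\widetilde Z}$ for another measurable function $\widetilde Z\colon\Theta\to(0,\infty)$. For a measure $\nu$ on $(\Theta,\mathcal B(\Theta))$, $p\ge 1$ and measurable $f\colon\Theta\to\mathbb{R}$, $\Vert f\Vert_{\nu,p} := \left(\int_\Theta |f(\theta)|^p\,\nu(\mathrm{d}\theta)\right)^{1/p}$. Total variation distance (note the normalization): $\Vert \nu_1-\nu_2\Vert_{\rm tv} := \sup_{|f|_\infty\le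 1}\left|\int f\,\mathrm{d}\nu_1-\int f\,\mathrm{d}\nu_2\right|$, the supremum being over measurable $f\colon\Theta\to\mathbb{R}$ with $|f|_\infty := \sup_{\theta\in\Theta}|f(\theta)|\le 1$. *)

theory Defs
  imports "HOL-Probability.Probability"
begin

text \<open>
  The space \<open>\<Theta>\<close> is a type of class \<^class>\<open>polish_space\<close> (complete separable metric) and the
  reference measure \<open>\<mu>\<close> lives on its Borel sets. Quantities that may a priori be infinite
  take values in \<^typ>\<open>ennreal\<close>, so that no integral or supremum is cut off by a totality
  convention.
\<close>

definition norm_const :: "'a measure \<Rightarrow> ('a \<Rightarrow> real) \<Rightarrow> ('a \<Rightarrow> real) \<Rightarrow> ennreal" where
  "norm_const \<mu> \<Phi> Z = (\<integral>\<^sup>+ \<theta>. ennreal (exp (- \<Phi> \<theta>) / Z \<theta>) \<partial>\<mu>)"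

text \<open>Only meaningful if \<open>0 < norm_const \<mu> \<Phi> Z < \<infinity>\<close>; see the two lemmas below.\<close>

definition gibbs :: "'a measure \<Rightarrow> ('a \<Rightarrow> real) \<Rightarrow> ('a \<Rightarrow> real) \<Rightarrow> 'a measure" where
  "gibbs \<mu> \<Phi> Z =
     scale_measure (1 / norm_const \<mu> \<Phi> Z) (density \<mu> (\<lambda>\<theta>. ennreal (exp (- \<Phi> \<theta>) / Z \<theta>)))"

text \<open>The root of an infinite integral is \<open>\<infinity>\<close>; there is no \<open>powr\<close> on \<^typ>\<open>ennreal\<close>.\<close>

definition Lp_norm :: "'a measure \<Rightarrow> real \<Rightarrow> ('a \<Rightarrow> real) \<Rightarrow> ennreal" where
  "Lp_norm \<nu> p f =
     (let I = (\<integral>\<^sup>+ \<theta>. ennreal (\<bar>f \<theta>\<bar> powr p) \<partial>\<nu>)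
      in if I = \<infinity> then \<infinity> else ennreal (enn2real I powr (1 / p)))"

definition sup_norm :: "('a \<Rightarrow> real) \<Rightarrow> ennreal" where
  "sup_norm f = (SUP \<theta>. ennreal \<bar>f \<theta>\<bar>)"

text \<open>
  Normalised so that mutually singular probability measures have distance 2. Intended for
  finite Borel measures, for which every admissible \<open>f\<close> is integrable.
\<close>

definition tv_dist :: "'a::topological_space measure \<Rightarrow> 'a measure \<Rightarrow> ennreal" where
  "tv_dist \<nu>\<^sub>1 \<nu>\<^sub>2 =
     (SUP f \<in> {f \<in> borel_measurable borel. sup_norm f \<le> 1}.
        ennreal \<bar>(\<integral>\<theta>. f \<theta> \<partial>\<nu>\<^sub>1) - (\<integral>\<theta>. f \<theta> \<partial>\<nu>\<^sub>2)\<bar>)"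

lemma emeasure_gibbs:
  assumes "sets \<mu> = sets borel" "\<Phi> \<in> borel_measurable borel" "Z \<in> borel_measurable borel"
    and "A \<in> sets borel"
  shows "emeasure (gibbs \<mu> \<Phi> Z) A =
    1 / norm_const \<mu> \<Phi> Z * (\<integral>\<^sup>+ \<theta> \<in> A. ennreal (exp (- \<Phi> \<theta>) / Z \<theta>) \<partial>\<mu>)"
proof -
  have [measurable_cong]: "sets \<mu> = sets borel" by fact
  note [measurable] = assms(2,3,4)
  have "(\<lambda>\<theta>. ennreal (exp (- \<Phi> \<theta>) / Z \<theta>)) \<in> borel_measurable \<mu>" by measurable
  then show ?thesis
    using assms by (simp add: gibbs_def emeasure_density)
qed

lemma prob_space_gibbs:
  assumes "sets \<mu> = sets borel" "\<Phi> \<in> borel_measurable borel" "Z \<in> borel_measurable borel"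
    and "0 < norm_const \<mu> \<Phi> Z" "norm_const \<mu> \<Phi> Z < \<infinity>"
  shows "prob_space (gibbs \<mu> \<Phi> Z)"
proof
  have sp: "space (gibbs \<mu> \<Phi> Z) = UNIV"
    using sets_eq_imp_space_eq[OF assms(1)] by (simp add: gibbs_def space_scale_measure)
  have "1 / norm_const \<mu> \<Phi> Z * norm_const \<mu> \<Phi> Z = 1"
    using assms(4,5) by (simp add: ennreal_divide_times)
  then show "emeasure (gibbs \<mu> \<Phi> Z) (space (gibbs \<mu> \<Phi> Z)) = 1"
    unfolding sp by (simp add: emeasure_gibbs[OF assms(1-3)] norm_const_def)
qed

end

theory Submission
  imports Defs
begin

text \<open>
  Put \<open>\<pi> = gibbs \<mu> \<Phi> Z\<close> and \<open>r = Z / Z'\<close>. The perturbed measure \<open>gibbs \<mu> \<Phi> Z'\<close> has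
  density \<open>r / m\<close> with respect to \<open>\<pi>\<close>, where \<open>m\<close> is the ratio of the two normalising constants
  (\<open>gibbs_eq_density_gibbs\<close>). The bound is then a statement about one probability measure and a
  density known only up to its normalisation (\<open>integral_diff_unnormalised_density_le\<close>). Pairing
  with \<open>f\<close>, \<open>\<bar>f\<bar> \<le> 1\<close>, costs at most \<open>\<integral> \<bar>1 - r / m\<bar> d\<pi>\<close>, and by the triangle inequality
  \<open>\<bar>1 - r / m\<bar> \<le> \<bar>r - 1\<bar> + \<bar>m - 1\<bar> * (r / m)\<close>. The first term integrates to the norm on
  the right-hand side, and the second to at most that norm: \<open>r / m\<close> has mass 1, and since \<open>m\<close> is the
  \<open>\<pi>\<close>-mean of \<open>r\<close>, \<open>\<bar>m - 1\<bar> = \<bar>\<integral> (r - 1) d\<pi>\<bar> \<le> \<integral> \<bar>r - 1\<bar> d\<pi>\<close>. This is the source of the factor 2.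
\<close>

text \<open>
  The factor 2 pays for two errors with the same bound: replacing 1 by \<open>r\<close>, and renormalising \<open>r\<close>.
  That \<open>m\<close> is the mean of \<open>r\<close>, and that \<open>r\<close> is integrable, is forced by the second measure being a
  probability measure.
\<close>

lemma integral_diff_unnormalised_density_le:
  fixes r f :: "'a \<Rightarrow> real"
  assumes "prob_space M" and "prob_space (density M (\<lambda>x. ennreal (r x / m)))"
    and [measurable]: "r \<in> borel_measurable M" "f \<in> borel_measurable M"
    and r: "\<And>x. 0 \<le> r x" and m: "0 < m" and f: "\<And>x. \<bar>f x\<bar> \<le> 1"
  shows "integrable M r"
    and "\<bar>(\<integral>x. f x \<partial>M) - (\<integral>x. f x \<partial>density M (\<lambda>x. ennreal (r x / m)))\<bar>
      \<le> 2 * (\<integral>x. \<bar>r x - 1\<bar> \<partial>M)"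
proof -
  interpret prob_space M by fact
  interpret N: prob_space "density M (\<lambda>x. ennreal (r x / m))" by fact
  have r_m: "0 \<le> r x / m" for x
    using r m by simp
  have "(\<integral>\<^sup>+x. ennreal (r x / m) \<partial>M) = 1"
    using N.emeasure_space_1 by (simp add: emeasure_density nn_integral_set_ennreal cong: nn_integral_cong)
  then have int_rm: "integrable M (\<lambda>x. r x / m)" and mass: "(\<integral>x. r x / m \<partial>M) = 1"
    using nn_integral_eq_integrable[of "\<lambda>x. r x / m" M 1] r_m by auto
  show int_r: "integrable M r"
    using integrable_mult_right[OF int_rm, of m] m by simp
  have mean: "(\<integral>x. r x \<partial>M) = m"
    using mass m by simp
  have int_f: "integrable M f"
    by (rule integrable_const_bound[of _ 1]) (use f in auto)
  have int_rf: "integrable M (\<lambda>x. r x / m * f x)"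
  proof (rule Bochner_Integration.integrable_bound[OF int_rm])
    show "AE x in M. norm (r x / m * f x) \<le> norm (r x / m)"
      using f by (auto simp: abs_mult intro!: divide_right_mono mult_left_le)
  qed simp
  have int_d: "integrable M (\<lambda>x. \<bar>r x - 1\<bar>)"
    using int_r by simp
  have m_1: "\<bar>m - 1\<bar> \<le> (\<integral>x. \<bar>r x - 1\<bar> \<partial>M)"
    using integral_abs_bound[of M "\<lambda>x. r x - 1"] int_r by (simp add: mean prob_space)
  have "(\<integral>x. f x \<partial>M) - (\<integral>x. f x \<partial>density M (\<lambda>x. ennreal (r x / m)))
      = (\<integral>x. f x - r x / m * f x \<partial>M)"
    using int_f int_rf r_m by (simp add: integral_density)
  also have "\<bar>\<dots>\<bar> \<le> (\<integral>x. \<bar>f x - r x / m * f x\<bar> \<partial>M)"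
    by (rule integral_abs_bound)
  also have "\<dots> \<le> (\<integral>x. \<bar>r x - 1\<bar> + \<bar>m - 1\<bar> * (r x / m) \<partial>M)"
  proof (rule integral_mono)
    fix x
    have "\<bar>f x - r x / m * f x\<bar> = \<bar>f x\<bar> * \<bar>1 - r x / m\<bar>"
      by (simp add: abs_mult[symmetric] algebra_simps)
    also have "\<dots> \<le> \<bar>1 - r x / m\<bar>"
      using f by (simp add: mult_left_le_one_le)
    also have "\<dots> = \<bar>- (r x - 1) + (m - 1) * (r x / m)\<bar>"
      using m by (simp add: field_simps)
    also have "\<dots> \<le> \<bar>r x - 1\<bar> + \<bar>m - 1\<bar> * (r x / m)"
      using r_m[of x] abs_triangle_ineq[of "- (r x - 1)" "(m - 1) * (r x / m)"]
      by (simp only: abs_mult abs_minus_cancel abs_of_nonneg)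
    finally show "\<bar>f x - r x / m * f x\<bar> \<le> \<bar>r x - 1\<bar> + \<bar>m - 1\<bar> * (r x / m)" .
  qed (use int_f int_rf int_d int_rm in \<open>auto simp del: times_divide_eq_right\<close>)
  also have "\<dots> = (\<integral>x. \<bar>r x - 1\<bar> \<partial>M) + \<bar>m - 1\<bar> * (\<integral>x. r x / m \<partial>M)"
    using int_d int_rm by (simp del: times_divide_eq_right integral_divide_zero)
  also have "\<dots> \<le> 2 * (\<integral>x. \<bar>r x - 1\<bar> \<partial>M)"
    unfolding mass using m_1 by simp
  finally show "\<bar>(\<integral>x. f x \<partial>M) - (\<integral>x. f x \<partial>density M (\<lambda>x. ennreal (r x / m)))\<bar>
      \<le> 2 * (\<integral>x. \<bar>r x - 1\<bar> \<partial>M)" .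
qed

lemma gibbs_eq_density:
  assumes [measurable_cong]: "sets \<mu> = sets borel"
    and [measurable]: "\<Phi> \<in> borel_measurable borel" "Z \<in> borel_measurable borel"
    and Z: "\<And>\<theta>. 0 < Z \<theta>"
    and C: "0 < norm_const \<mu> \<Phi> Z" "norm_const \<mu> \<Phi> Z < \<infinity>"
  shows "gibbs \<mu> \<Phi> Z =
    density \<mu> (\<lambda>\<theta>. ennreal (exp (- \<Phi> \<theta>) / Z \<theta> / enn2real (norm_const \<mu> \<Phi> Z)))"
proof -
  define c where "c = enn2real (norm_const \<mu> \<Phi> Z)"
  have c: "0 < c" "norm_const \<mu> \<Phi> Z = ennreal c"
    using C by (auto simp: c_def enn2real_positive_iff)
  have w: "0 \<le> exp (- \<Phi> \<theta>) / Z \<theta>" for \<theta>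
    using Z[of \<theta>] by simp
  have "ennreal (exp (- \<Phi> \<theta>) / Z \<theta> / c) = 1 / ennreal c * ennreal (exp (- \<Phi> \<theta>) / Z \<theta>)" for \<theta>
    by (simp add: divide_ennreal[OF w c(1), symmetric] ennreal_divide_times
        del: divide_divide_eq_left)
  then show ?thesis
    unfolding gibbs_def c_def[symmetric] unfolding c(2)
    by (intro measure_eqI)
       (simp_all add: emeasure_density nn_integral_cmult mult.assoc del: divide_divide_eq_left)
qed

lemma gibbs_eq_density_gibbs:
  assumes sets[measurable_cong]: "sets \<mu> = sets borel"
    and \<Phi>[measurable]: "\<Phi> \<in> borel_measurable borel"
    and Z[measurable]: "Z \<in> borel_measurable borel" and Z_pos: "\<And>\<theta>. 0 < Z \<theta>"
    and Z'[measurable]: "Z' \<in> borel_measurable borel" and Z'_pos: "\<And>\<theta>. 0 < Z' \<theta>"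
    and C: "0 < norm_const \<mu> \<Phi> Z" "norm_const \<mu> \<Phi> Z < \<infinity>"
    and C': "0 < norm_const \<mu> \<Phi> Z'" "norm_const \<mu> \<Phi> Z' < \<infinity>"
  shows "gibbs \<mu> \<Phi> Z' = density (gibbs \<mu> \<Phi> Z)
    (\<lambda>\<theta>. ennreal (Z \<theta> / Z' \<theta> / (enn2real (norm_const \<mu> \<Phi> Z') / enn2real (norm_const \<mu> \<Phi> Z))))"
proof -
  define c c' where "c = enn2real (norm_const \<mu> \<Phi> Z)" and "c' = enn2real (norm_const \<mu> \<Phi> Z')"
  have c: "0 < c" "0 < c'"
    using C C' by (auto simp: c_def c'_def enn2real_positive_iff)
  have "ennreal (exp (- \<Phi> \<theta>) / Z \<theta> / c) * ennreal (Z \<theta> / Z' \<theta> / (c' / c))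
      = ennreal (exp (- \<Phi> \<theta>) / Z' \<theta> / c')" for \<theta>
    using Z_pos[of \<theta>] Z'_pos[of \<theta>] c
    by (simp add: ennreal_mult[symmetric] field_simps)
  then show ?thesis
    unfolding gibbs_eq_density[OF sets \<Phi> Z Z_pos C] gibbs_eq_density[OF sets \<Phi> Z' Z'_pos C']
      c_def[symmetric] c'_def[symmetric]
    by (subst density_density_eq) simp_all
qed

lemma sup_norm_le_1_iff: "sup_norm f \<le> 1 \<longleftrightarrow> (\<forall>\<theta>. \<bar>f \<theta>\<bar> \<le> 1)"
  by (simp add: sup_norm_def SUP_le_iff)

lemma Lp_norm_1_eq_integral:
  assumes "integrable \<nu> f"
  shows "Lp_norm \<nu> 1 f = ennreal (\<integral>\<theta>. \<bar>f \<theta>\<bar> \<partial>\<nu>)"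
  using assms by (simp add: Lp_norm_def nn_integral_eq_integral Let_def)

theorem theorem2p1:
  fixes \<mu> :: "'a::polish_space measure"
    and \<Phi> Z Z' :: "'a \<Rightarrow> real"
  assumes "sets \<mu> = sets borel" and "sigma_finite_measure \<mu>"
    and "\<Phi> \<in> borel_measurable borel"
    and "Z \<in> borel_measurable borel" and "\<And>\<theta>. 0 < Z \<theta>"
    and "Z' \<in> borel_measurable borel" and "\<And>\<theta>. 0 < Z' \<theta>"
    and "0 < norm_const \<mu> \<Phi> Z" and "norm_const \<mu> \<Phi> Z < \<infinity>"
    and "0 < norm_const \<mu> \<Phi> Z'" and "norm_const \<mu> \<Phi> Z' < \<infinity>"
  shows "tv_dist (gibbs \<mu> \<Phi> Z) (gibbs \<mu> \<Phi> Z')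
    \<le> 2 * Lp_norm (gibbs \<mu> \<Phi> Z) 1 (\<lambda>\<theta>. Z \<theta> / Z' \<theta> - 1)"
proof -
  let ?P = "gibbs \<mu> \<Phi> Z" and ?P' = "gibbs \<mu> \<Phi> Z'"
  define r where "r = (\<lambda>\<theta>. Z \<theta> / Z' \<theta>)"
  define m where "m = enn2real (norm_const \<mu> \<Phi> Z') / enn2real (norm_const \<mu> \<Phi> Z)"
  note [measurable] = assms(4,6)
  have [measurable_cong]: "sets ?P = sets borel"
    using assms(1) by (simp add: gibbs_def)
  have P: "prob_space ?P" and P': "prob_space ?P'"
    using assms by (auto intro: prob_space_gibbs)
  have dens: "?P' = density ?P (\<lambda>\<theta>. ennreal (r \<theta> / m))"
    unfolding r_def m_def by (rule gibbs_eq_density_gibbs) fact+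
  have r_meas: "r \<in> borel_measurable ?P"
    unfolding r_def by measurable
  have r: "0 \<le> r \<theta>" for \<theta>
    using assms(5,7) by (simp add: r_def less_imp_le)
  have m: "0 < m"
    using assms(8-11) by (simp add: m_def enn2real_positive_iff)
  note bound = integral_diff_unnormalised_density_le[OF P P'[unfolded dens] r_meas _ r m]
  interpret prob_space ?P by fact
  \<comment> \<open>Integrability of \<open>r\<close> does not depend on the test function, so any admissible one will do.\<close>
  have "integrable ?P r"
    by (rule bound(1)[of "\<lambda>_. 0"]) auto
  then have L1: "Lp_norm ?P 1 (\<lambda>\<theta>. r \<theta> - 1) = ennreal (\<integral>\<theta>. \<bar>r \<theta> - 1\<bar> \<partial>?P)"
    by (intro Lp_norm_1_eq_integral) simp
  have "tv_dist ?P ?P' \<le> ennreal (2 * (\<integral>\<theta>. \<bar>r \<theta> - 1\<bar> \<partial>?P))"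
    unfolding tv_dist_def dens
  proof (intro SUP_least ennreal_leI)
    fix f :: "'a \<Rightarrow> real"
    assume "f \<in> {f \<in> borel_measurable borel. sup_norm f \<le> 1}"
    then have [measurable]: "f \<in> borel_measurable borel" and "\<And>\<theta>. \<bar>f \<theta>\<bar> \<le> 1"
      by (auto simp: sup_norm_le_1_iff)
    then show "\<bar>(\<integral>\<theta>. f \<theta> \<partial>?P) - (\<integral>\<theta>. f \<theta> \<partial>density ?P (\<lambda>\<theta>. ennreal (r \<theta> / m)))\<bar>
        \<le> 2 * (\<integral>\<theta>. \<bar>r \<theta> - 1\<bar> \<partial>?P)"
      by (intro bound(2)) measurable
  qed
  also have "\<dots> = 2 * Lp_norm ?P 1 (\<lambda>\<theta>. r \<theta> - 1)"
    by (simp add: L1 ennreal_mult)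
  finally show ?thesis
    by (simp add: r_def)
qed

end
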